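(* Let $\Omega\subset\mathbb{R}$ be a bounded interval and $\alpha>0$. A function $u\in W^3_{\alpha+1,B}(\Omega)$ is a positive steady-state solution of $$ \begin{cases} u_t+\bigl(u^{\alpha+2}|u_{xxx}|^{\alpha-1}u_{xxx}\bigr)_x=0, & t>0,\ x\in\Omega,\\ u_x=u_{xxx}=0, & t>0,\ x\in\partial\Omega, \end{cases} $$ if and only if $u\equiv u^*\in\mathbb{R}_{>0}$ is given by a positive constant.
   Context: $W^3_{\alpha+1,B}(\Omega)=\{v\in W^3_{\alpha+1}(\Omega):v_x=0\text{ on }\partial\Omega\}$. A steady-state solution is a function $U\in W^3_{\alpha+1,B}(\Omega)$ solving $U^{\alpha+2}|U'''|^{\alpha-1}U'''=0$ in $\Omega$ (almost everywhere); it is positive if $U(x)>0$ for all $x\in\bar\Omega$. *)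

theory Defs
  imports "HOL-Analysis.Analysis"
begin

text \<open>
  Elements of function spaces are represented by functions \<open>real \<Rightarrow> real\<close>, of which only the
  almost-everywhere class on \<open>\<Omega>\<close> matters. Pointwise values on \<open>closure \<Omega>\<close> (boundary values,
  positivity) are those of the continuous representative, which exists on a bounded interval by the
  Sobolev embedding and is unique. The definitions are meant for open \<open>\<Omega>\<close>.
\<close>

definition Lp_fun :: "real \<Rightarrow> real set \<Rightarrow> (real \<Rightarrow> real) set" where
  "Lp_fun p \<Omega> = {f. set_borel_measurable lebesgue \<Omega> f \<and>
                     set_integrable lebesgue \<Omega> (\<lambda>x. \<bar>f x\<bar> powr p)}"

definition locally_integrable :: "real set \<Rightarrow> (real \<Rightarrow> real) \<Rightarrow> bool" where
  "locally_integrable \<Omega> f \<longleftrightarrow> (\<forall>K. compact K \<and> K \<subseteq> \<Omega> \<longrightarrow> set_integrable lebesgue K f)"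

definition test_fun :: "real set \<Rightarrow> (real \<Rightarrow> real) set" where
  "test_fun \<Omega> = {\<phi>. (\<forall>n x. (deriv ^^ n) \<phi> differentiable (at x)) \<and>
                     compact (closure {x. \<phi> x \<noteq> 0}) \<and> closure {x. \<phi> x \<noteq> 0} \<subseteq> \<Omega>}"

definition has_weak_deriv :: "real set \<Rightarrow> nat \<Rightarrow> (real \<Rightarrow> real) \<Rightarrow> (real \<Rightarrow> real) \<Rightarrow> bool" where
  "has_weak_deriv \<Omega> k u v \<longleftrightarrow>
     locally_integrable \<Omega> u \<and> locally_integrable \<Omega> v \<and>
     (\<forall>\<phi>\<in>test_fun \<Omega>.
        (LINT x:\<Omega>|lebesgue. u x * (deriv ^^ k) \<phi> x) = (-1) ^ k * (LINT x:\<Omega>|lebesgue. v x * \<phi> x))"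

definition Sobolev :: "nat \<Rightarrow> real \<Rightarrow> real set \<Rightarrow> (real \<Rightarrow> real) set" where
  "Sobolev k p \<Omega> = {u \<in> Lp_fun p \<Omega>. \<forall>j\<in>{1..k}. \<exists>v\<in>Lp_fun p \<Omega>. has_weak_deriv \<Omega> j u v}"

definition cont_rep :: "real set \<Rightarrow> (real \<Rightarrow> real) \<Rightarrow> (real \<Rightarrow> real) \<Rightarrow> bool" where
  "cont_rep \<Omega> f g \<longleftrightarrow> continuous_on (closure \<Omega>) g \<and> (AE x in lebesgue. x \<in> \<Omega> \<longrightarrow> f x = g x)"

definition W3B :: "real \<Rightarrow> real set \<Rightarrow> (real \<Rightarrow> real) set" where
  "W3B \<alpha> \<Omega> = {v \<in> Sobolev 3 (\<alpha> + 1) \<Omega>.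
     \<exists>w g. has_weak_deriv \<Omega> 1 v w \<and> cont_rep \<Omega> w g \<and> (\<forall>x\<in>frontier \<Omega>. g x = 0)}"

text \<open>
  For \<open>U'''(x) = 0\<close> and \<open>\<alpha> < 1\<close> the term \<open>\<bar>U'''\<bar>\<^sup>\<alpha>\<^sup>-\<^sup>1 U'''\<close> is understood as \<open>0\<close>; this is what
  \<open>0 powr _ = 0\<close> gives. The power \<open>U\<^sup>\<alpha>\<^sup>+\<^sup>2\<close> has its usual meaning only for \<open>U \<ge> 0\<close>.
\<close>

definition steady_state :: "real \<Rightarrow> real set \<Rightarrow> (real \<Rightarrow> real) \<Rightarrow> bool" where
  "steady_state \<alpha> \<Omega> U \<longleftrightarrow> U \<in> W3B \<alpha> \<Omega> \<and>
     (\<exists>w. has_weak_deriv \<Omega> 3 U w \<and>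
          (AE x in lebesgue. x \<in> \<Omega> \<longrightarrow>
             U x powr (\<alpha> + 2) * \<bar>w x\<bar> powr (\<alpha> - 1) * w x = 0))"

definition positive_steady_state :: "real \<Rightarrow> real set \<Rightarrow> (real \<Rightarrow> real) \<Rightarrow> bool" where
  "positive_steady_state \<alpha> \<Omega> U \<longleftrightarrow> steady_state \<alpha> \<Omega> U \<and>
     (\<exists>g. cont_rep \<Omega> U g \<and> (\<forall>x\<in>closure \<Omega>. g x > 0))"

end

theory Submission
  imports Defs
begin

text \<open>
  Since \<open>U > 0\<close>, the equation forces \<open>U''' = 0\<close>, so the continuous representative \<open>h\<close> of \<open>U'\<close>
  satisfies \<open>\<integral> h \<phi>'' = 0\<close> for all test functions. Fix a test function \<open>\<eta>\<close> with \<open>\<integral> \<eta> = 1\<close>; on an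
  interval, every test function is \<open>\<phi> = \<psi>' + (\<integral> \<phi>) \<eta>\<close> with \<open>\<psi>\<close> a test function
  (du Bois-Reymond). Hence \<open>h\<close> is affine, and it vanishes at both end points, so \<open>h = 0\<close>; the same
  argument applied to \<open>U\<close> shows that \<open>U\<close> is constant.
\<close>

section \<open>Smooth functions on the real line and their closure properties\<close>

definition smooth :: "(real \<Rightarrow> real) \<Rightarrow> bool" where
  "smooth f \<longleftrightarrow> (\<forall>n x. (deriv ^^ n) f differentiable (at x))"

text \<open>The iterated derivatives of a concrete function rarely have a usable closed form. A
  class of functions that is closed under differentiation contains all of them by induction, so each
  smoothness proof below reduces to finding such a class \<open>P\<close>.\<close>

lemma smooth_coinduct:
  assumes "P f" and step: "\<And>f. P f \<Longrightarrow> \<exists>f'. (\<forall>x. (f has_real_derivative f' x) (at x)) \<and> P f'"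
  shows "smooth f"
proof -
  have "P ((deriv ^^ n) f)" for n
  proof (induction n)
    case (Suc n)
    from step[OF Suc] obtain f' where "\<forall>x. ((deriv ^^ n) f has_real_derivative f' x) (at x)" "P f'"
      by blast
    moreover from this have "deriv ((deriv ^^ n) f) = f'"
      by (auto intro!: DERIV_imp_deriv)
    ultimately show ?case by simp
  qed (simp add: assms)
  then show ?thesis
    unfolding smooth_def by (meson step real_differentiable_def)
qed

lemma smooth_DERIV:
  assumes "smooth f"
  shows "(f has_real_derivative deriv f x) (at x)"
proof -
  have "(deriv ^^ 0) f differentiable (at x)"
    using assms unfolding smooth_def by blast
  then show ?thesis
    by (simp add: DERIV_deriv_iff_real_differentiable)
qed

lemma smooth_deriv: "smooth f \<Longrightarrow> smooth (deriv f)"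
  unfolding smooth_def by (metis funpow_Suc_right comp_apply)

lemma smooth_isCont: "smooth f \<Longrightarrow> isCont f x"
  using smooth_DERIV DERIV_isCont by blast

lemma smooth_continuous_on: "smooth f \<Longrightarrow> continuous_on S f"
  by (simp add: continuous_at_imp_continuous_on smooth_isCont)

text \<open>Adding \<open>f\<close> to the class of smooth functions keeps it closed under
  differentiation, because the derivative of \<open>f\<close> is already in the class.\<close>

lemma smooth_antideriv:
  assumes "smooth f'" "\<And>x. (f has_real_derivative f' x) (at x)"
  shows "smooth f"
proof (rule smooth_coinduct[where P = "\<lambda>g. g = f \<or> smooth g"])
  fix g assume "g = f \<or> smooth g"
  then show "\<exists>g'. (\<forall>x. (g has_real_derivative g' x) (at x)) \<and> (g' = f \<or> smooth g')"
  proof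
    assume "g = f"
    then show ?thesis using assms by (intro exI[of _ f']) simp
  next
    assume "smooth g"
    then show ?thesis by (intro exI[of _ "deriv g"]) (simp add: smooth_DERIV smooth_deriv)
  qed
qed simp

lemma smooth_lincomb:
  assumes "smooth f" "smooth g"
  shows "smooth (\<lambda>x. r * f x + s * g x)"
proof (rule smooth_coinduct[where P = "\<lambda>h. \<exists>f g. smooth f \<and> smooth g \<and> h = (\<lambda>x. r * f x + s * g x)"])
  fix h assume "\<exists>f g. smooth f \<and> smooth g \<and> h = (\<lambda>x. r * f x + s * g x)"
  then obtain f g where fg: "smooth f" "smooth g" and h: "h = (\<lambda>x. r * f x + s * g x)" by blast
  have "(h has_real_derivative r * deriv f x + s * deriv g x) (at x)" for x
    unfolding h by (intro DERIV_add DERIV_cmult smooth_DERIV fg)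
  moreover have "\<exists>f' g'. smooth f' \<and> smooth g' \<and>
      (\<lambda>x. r * deriv f x + s * deriv g x) = (\<lambda>x. r * f' x + s * g' x)"
    by (intro exI[of _ "deriv f"] exI[of _ "deriv g"]) (simp add: smooth_deriv fg)
  ultimately show "\<exists>h'. (\<forall>x. (h has_real_derivative h' x) (at x)) \<and>
      (\<exists>f g. smooth f \<and> smooth g \<and> h' = (\<lambda>x. r * f x + s * g x))"
    by (intro exI[of _ "\<lambda>x. r * deriv f x + s * deriv g x"]) simp
next
  show "\<exists>f' g'. smooth f' \<and> smooth g' \<and> (\<lambda>x. r * f x + s * g x) = (\<lambda>x. r * f' x + s * g' x)"
    using assms by (intro exI[of _ f] exI[of _ g]) simp
qed

lemma smooth_compose_affine:
  assumes "smooth f"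
  shows "smooth (\<lambda>x. f (r * x + s))"
\<comment> \<open>The free factor \<open>t\<close> collects the powers of \<open>r\<close> that the
  chain rule produces.\<close>
proof (rule smooth_coinduct[where P = "\<lambda>h. \<exists>g t. smooth g \<and> h = (\<lambda>x. t * g (r * x + s))"])
  show "\<exists>g t. smooth g \<and> (\<lambda>x. f (r * x + s)) = (\<lambda>x. t * g (r * x + s))"
    using assms by (intro exI[of _ f] exI[of _ 1]) simp
next
  fix h assume "\<exists>g t. smooth g \<and> h = (\<lambda>x. t * g (r * x + s))"
  then obtain g t where g: "smooth g" and h: "h = (\<lambda>x. t * g (r * x + s))" by blast
  have "((\<lambda>x. r * x + s) has_real_derivative r) (at x)" for x
    by (auto intro!: derivative_eq_intros)
  then have "(h has_real_derivative t * (deriv g (r * x + s) * r)) (at x)" for x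
    unfolding h by (intro DERIV_cmult DERIV_chain2[OF smooth_DERIV[OF g]])
  moreover have "\<exists>g' t'. smooth g' \<and>
      (\<lambda>x. t * (deriv g (r * x + s) * r)) = (\<lambda>x. t' * g' (r * x + s))"
    by (intro exI[of _ "deriv g"] exI[of _ "t * r"]) (simp add: smooth_deriv g mult_ac)
  ultimately show "\<exists>h'. (\<forall>x. (h has_real_derivative h' x) (at x)) \<and>
      (\<exists>g t. smooth g \<and> h' = (\<lambda>x. t * g (r * x + s)))"
    by (intro exI[of _ "\<lambda>x. t * (deriv g (r * x + s) * r)"]) simp
qed

text \<open>Coinduction on the finite sums of products, a class closed under differentiation.\<close>

lemma smooth_mult:
  assumes "smooth f" "smooth g"
  shows "smooth (\<lambda>x. f x * g x)"
proof (rule smooth_coinduct[where P = "\<lambda>h. \<exists>ps. (\<forall>(p, q)\<in>set ps. smooth p \<and> smooth q) \<and>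
    h = (\<lambda>x. \<Sum>(p, q)\<leftarrow>ps. p x * q x)"], goal_cases)
  case 1
  show ?case using assms by (intro exI[of _ "[(f, g)]"]) auto
next
  case (2 h)
  then obtain ps where ps: "\<forall>(p, q)\<in>set ps. smooth p \<and> smooth q"
    and h: "h = (\<lambda>x. \<Sum>(p, q)\<leftarrow>ps. p x * q x)" by blast
  have "\<exists>qs. (\<forall>(p, q)\<in>set qs. smooth p \<and> smooth q) \<and>
    (\<forall>x. ((\<lambda>x. \<Sum>(p, q)\<leftarrow>ps. p x * q x) has_real_derivative (\<Sum>(p, q)\<leftarrow>qs. p x * q x)) (at x))"
    using ps
  proof (induction ps)
    case Nil
    show ?case by (intro exI[of _ "[]"]) auto
  next
    case (Cons a ps)
    obtain p q where a: "a = (p, q)" by (cases a)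
    from Cons obtain qs where qs: "\<forall>(p, q)\<in>set qs. smooth p \<and> smooth q"
      "\<And>x. ((\<lambda>x. \<Sum>(p, q)\<leftarrow>ps. p x * q x) has_real_derivative (\<Sum>(p, q)\<leftarrow>qs. p x * q x)) (at x)"
      by auto
    have pq: "smooth p" "smooth q" using Cons a by auto
    show ?case
      by (rule exI[of _ "(deriv p, q) # (p, deriv q) # qs"])
        (use pq qs a in \<open>auto intro!: derivative_eq_intros smooth_DERIV smooth_deriv simp: algebra_simps\<close>)
  qed
  then obtain qs where "\<forall>(p, q)\<in>set qs. smooth p \<and> smooth q"
    "\<forall>x. (h has_real_derivative (\<Sum>(p, q)\<leftarrow>qs. p x * q x)) (at x)"
    unfolding h by blast
  then show ?case
    by (intro exI[of _ "\<lambda>x. \<Sum>(p, q)\<leftarrow>qs. p x * q x"] conjI exI[of _ qs]) simp_all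
qed

section \<open>A smooth bump function from exp(-1/x)\<close>

definition exp_flat :: "real poly \<Rightarrow> real \<Rightarrow> real" where
  "exp_flat p x = (if x \<le> 0 then 0 else poly p (1 / x) * exp (- (1 / x)))"

lemma poly_mult_exp_minus_tendsto_0: "((\<lambda>x::real. poly p x * exp (- x)) \<longlongrightarrow> 0) at_top"
proof -
  have "((\<lambda>x::real. \<Sum>i\<le>degree p. coeff p i * (x ^ i / exp x)) \<longlongrightarrow> (\<Sum>i\<le>degree p. coeff p i * 0)) at_top"
    by (intro tendsto_intros tendsto_power_div_exp_0)
  then show ?thesis
    by (simp add: poly_altdef sum_distrib_right exp_minus divide_inverse mult.assoc)
qed

text \<open>With y = 1/x, d/dx is -y^2 d/dy, so p(y) exp(-y) has the derivative y^2 (p - p')(y)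
  exp(-y); the factor y^2 is \<open>[:0, 0, 1:]\<close>. At the origin both sides vanish, since the
  exponential beats every polynomial.\<close>

lemma exp_flat_DERIV:
  "(exp_flat p has_real_derivative exp_flat ([:0, 0, 1:] * (p - pderiv p)) x) (at x)"
proof (cases x "0::real" rule: linorder_cases)
  case less
  have "(exp_flat p has_real_derivative 0) (at x)"
    by (rule has_field_derivative_transform_within_open[of "\<lambda>_. 0" _ _ "{..<0}"])
      (use less in \<open>auto simp: exp_flat_def\<close>)
  then show ?thesis using less by (simp add: exp_flat_def)
next
  case equal
  have "((\<lambda>h. exp_flat p h / h) \<longlongrightarrow> 0) (at_right 0)"
  proof (rule Lim_transform_eventually)
    \<comment> \<open>Dividing by \<open>h\<close> multiplies by \<open>inverse h\<close>; in the
      variable \<open>inverse h\<close> this raises the polynomial to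
      \<open>pCons 0 p\<close>.\<close>
    show "((\<lambda>h. poly (pCons 0 p) (inverse h) * exp (- inverse h)) \<longlongrightarrow> 0) (at_right 0)"
      by (rule filterlim_compose[OF poly_mult_exp_minus_tendsto_0 filterlim_inverse_at_top_right])
    show "\<forall>\<^sub>F h in at_right 0. poly (pCons 0 p) (inverse h) * exp (- inverse h) = exp_flat p h / h"
      by (auto simp: eventually_at_right_less exp_flat_def field_simps eventually_at_filter)
  qed
  moreover have "((\<lambda>h. exp_flat p h / h) \<longlongrightarrow> 0) (at_left 0)"
    by (rule Lim_transform_eventually[of "\<lambda>_. 0"])
      (auto simp: exp_flat_def eventually_at_filter)
  ultimately have "((\<lambda>h. exp_flat p h / h) \<longlongrightarrow> 0) (at 0)"
    by (simp add: filterlim_split_at)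
  then show ?thesis
    using equal by (simp add: DERIV_def exp_flat_def)
next
  case greater
  have "((\<lambda>x. poly p (1 / x) * exp (- (1 / x))) has_real_derivative
      exp_flat ([:0, 0, 1:] * (p - pderiv p)) x) (at x)"
    using greater
    by (auto intro!: derivative_eq_intros DERIV_chain2[OF poly_DERIV]
        simp: exp_flat_def field_simps power2_eq_square)
  then show ?thesis
    by (rule has_field_derivative_transform_within_open[of _ _ _ "{0<..}"])
      (use greater in \<open>auto simp: exp_flat_def\<close>)
qed

text \<open>The function exp(-1/x) alone does not form a class closed under differentiation, but the
  family over all polynomials does; hence the parameter \<open>p\<close>.\<close>

lemma smooth_exp_flat: "smooth (exp_flat p)"
proof (rule smooth_coinduct[where P = "\<lambda>f. \<exists>p. f = exp_flat p"])
  fix f assume "\<exists>p. f = exp_flat p"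
  then obtain p where "f = exp_flat p" by blast
  then show "\<exists>f'. (\<forall>x. (f has_real_derivative f' x) (at x)) \<and> (\<exists>p. f' = exp_flat p)"
    using exp_flat_DERIV[of p] by (intro exI[of _ "exp_flat ([:0, 0, 1:] * (p - pderiv p))"]) blast
qed blast

text \<open>A function flat to the left of \<open>c\<close> times the mirror image of one at
  \<open>d\<close>. For \<open>c\<close> \<ge> \<open>d\<close> the product is zero and the interval
  is empty, so no order of the end points is assumed.\<close>

lemma exists_smooth_bump:
  obtains f where "smooth f" "\<And>x. f x \<ge> 0" "\<And>x. f x > 0 \<longleftrightarrow> x \<in> {c<..<d}"
proof
  let ?e = "exp_flat [:1:]"
  have e: "?e x \<ge> 0" "?e x > 0 \<longleftrightarrow> x > 0" for x by (auto simp: exp_flat_def)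
  show "smooth (\<lambda>x. ?e (x - c) * ?e (d - x))"
    using smooth_mult[OF smooth_compose_affine[OF smooth_exp_flat[of "[:1:]"], of 1 "- c"]
        smooth_compose_affine[OF smooth_exp_flat[of "[:1:]"], of "- 1" d]]
    by (simp add: add.commute)
  show "?e (x - c) * ?e (d - x) \<ge> 0" for x by (simp add: e)
  show "?e (x - c) * ?e (d - x) > 0 \<longleftrightarrow> x \<in> {c<..<d}" for x
    using e[of "x - c"] e[of "d - x"] by (auto simp: zero_less_mult_iff)
qed

section \<open>Test functions, local integrability and weak derivatives\<close>

lemma compact_subset_open_interval:
  fixes a b :: real
  assumes "compact K" "K \<subseteq> {a<..<b}" "a < b"
  obtains c d where "a < c" "c \<le> d" "d < b" "K \<subseteq> {c..d}"
proof (cases "K = {}")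
  case True
  then show ?thesis
    using assms that[of "(a + b) / 2" "(a + b) / 2"] by auto
next
  case False
  obtain c where c: "c \<in> K" "\<forall>x\<in>K. c \<le> x" using compact_attains_inf assms(1) False by blast
  obtain d where d: "d \<in> K" "\<forall>x\<in>K. x \<le> d" using compact_attains_sup assms(1) False by blast
  have "K \<subseteq> {c..d}" using c d by auto
  moreover have "a < c" "d < b" "c \<le> d" using c d assms(2) by auto
  ultimately show ?thesis using that by blast
qed

lemma test_fun_smooth: "\<phi> \<in> test_fun \<Omega> \<Longrightarrow> smooth \<phi>"
  by (auto simp: test_fun_def smooth_def)

lemma test_fun_support:
  assumes "\<phi> \<in> test_fun \<Omega>"
  obtains K where "compact K" "K \<subseteq> \<Omega>" "\<And>x. x \<notin> K \<Longrightarrow> \<phi> x = 0"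
proof (rule that)
  show "compact (closure {x. \<phi> x \<noteq> 0})" "closure {x. \<phi> x \<noteq> 0} \<subseteq> \<Omega>"
    using assms by (auto simp: test_fun_def)
  show "\<phi> x = 0" if "x \<notin> closure {x. \<phi> x \<noteq> 0}" for x
    using that closure_subset[of "{x. \<phi> x \<noteq> 0}"] by auto
qed

lemma test_funI:
  assumes "smooth \<phi>" "compact K" "K \<subseteq> \<Omega>" "\<And>x. x \<notin> K \<Longrightarrow> \<phi> x = 0"
  shows "\<phi> \<in> test_fun \<Omega>"
proof -
  have "closure {x. \<phi> x \<noteq> 0} \<subseteq> K"
    by (rule closure_minimal) (use assms compact_imp_closed in auto)
  then show ?thesis
    using assms closed_closure bounded_subset unfolding test_fun_def smooth_def compact_eq_bounded_closed
    by blast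
qed

lemma test_fun_deriv:
  assumes "\<phi> \<in> test_fun \<Omega>"
  shows "deriv \<phi> \<in> test_fun \<Omega>"
proof -
  obtain K where K: "compact K" "K \<subseteq> \<Omega>" "\<And>x. x \<notin> K \<Longrightarrow> \<phi> x = 0"
    using test_fun_support[OF assms] by blast
  have "deriv \<phi> x = 0" if "x \<notin> K" for x
  proof (rule DERIV_imp_deriv)
    show "(\<phi> has_real_derivative 0) (at x)"
      by (rule has_field_derivative_transform_within_open[of "\<lambda>_. 0" _ _ "- K"])
        (use that K compact_imp_closed in auto)
  qed
  then show ?thesis
    by (intro test_funI[OF _ K(1,2)] smooth_deriv test_fun_smooth[OF assms])
qed

lemma test_fun_lincomb:
  assumes "\<phi> \<in> test_fun \<Omega>" "\<psi> \<in> test_fun \<Omega>"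
  shows "(\<lambda>x. r * \<phi> x + s * \<psi> x) \<in> test_fun \<Omega>"
proof -
  obtain K where "compact K" "K \<subseteq> \<Omega>" "\<And>x. x \<notin> K \<Longrightarrow> \<phi> x = 0"
    using test_fun_support[OF assms(1)] by blast
  moreover obtain L where "compact L" "L \<subseteq> \<Omega>" "\<And>x. x \<notin> L \<Longrightarrow> \<psi> x = 0"
    using test_fun_support[OF assms(2)] by blast
  ultimately show ?thesis
    by (intro test_funI[of _ "K \<union> L"] smooth_lincomb assms[THEN test_fun_smooth]) auto
qed

lemma locally_integrable_continuous:
  assumes "continuous_on \<Omega> f"
  shows "locally_integrable \<Omega> f"
  unfolding locally_integrable_def set_integrable_def
proof (intro allI impI)
  fix K assume K: "compact K \<and> K \<subseteq> \<Omega>"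
  then have "integrable lborel (\<lambda>x. indicator K x *\<^sub>R f x)"
    using borel_integrable_compact continuous_on_subset[OF assms] by blast
  then show "integrable lebesgue (\<lambda>x. indicator K x *\<^sub>R f x)"
    by (simp add: integrable_completion borel_measurable_integrable)
qed

text \<open>Trades \<open>\<Omega>\<close> for a compact set containing the support of
  \<open>\<phi>\<close>: a locally integrable \<open>f\<close> need be integrable only
  there.\<close>

lemma test_fun_mult_indicator:
  fixes f :: "real \<Rightarrow> real"
  assumes "K \<subseteq> \<Omega>" "\<And>x. x \<notin> K \<Longrightarrow> \<phi> x = (0::real)"
  shows "(\<lambda>x. indicator \<Omega> x *\<^sub>R (f x * \<phi> x)) = (\<lambda>x. (indicator K x *\<^sub>R f x) * \<phi> x)"
  using assms by (fastforce simp: indicator_def)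

lemma locally_integrable_mult_test_fun:
  assumes "locally_integrable \<Omega> f" "\<phi> \<in> test_fun \<Omega>"
  shows "set_integrable lebesgue \<Omega> (\<lambda>x. f x * \<phi> x)"
proof -
  obtain K where K: "compact K" "K \<subseteq> \<Omega>" "\<And>x. x \<notin> K \<Longrightarrow> \<phi> x = 0"
    using test_fun_support[OF assms(2)] by blast
  have f: "integrable lebesgue (\<lambda>x. indicator K x *\<^sub>R f x)"
    using assms(1) K unfolding locally_integrable_def set_integrable_def by blast
  have cont: "continuous_on UNIV \<phi>"
    using assms(2) smooth_continuous_on test_fun_smooth by blast
  then have meas: "\<phi> \<in> borel_measurable lebesgue"
    by (simp add: borel_measurable_continuous_onI measurable_completion)
  have "bounded (\<phi> ` K)"
    using K cont by (meson compact_continuous_image compact_imp_bounded continuous_on_subset subset_UNIV)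
  then obtain B where B: "\<And>x. x \<in> K \<Longrightarrow> \<bar>\<phi> x\<bar> \<le> B" "B > 0"
    by (auto simp: bounded_pos)
  have "integrable lebesgue (\<lambda>x. (indicator K x *\<^sub>R f x) * \<phi> x)"
    \<comment> \<open>On the compact set \<open>K\<close> the continuous \<open>\<phi>\<close> is
      bounded by \<open>B\<close>, so \<open>B\<close> times the restriction of \<open>f\<close> to
      \<open>K\<close> dominates the product.\<close>
    by (rule Bochner_Integration.integrable_bound[of _ "\<lambda>x. B * (indicator K x *\<^sub>R f x)"])
      (use f meas B in \<open>auto simp: abs_mult indicator_def mult.commute intro!: mult_right_mono\<close>)
  then show ?thesis
    unfolding set_integrable_def using test_fun_mult_indicator[OF K(2,3), where f = f] by simp
qed

lemma test_fun_integrable: "\<phi> \<in> test_fun \<Omega> \<Longrightarrow> set_integrable lebesgue \<Omega> \<phi>"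
  using locally_integrable_mult_test_fun[OF locally_integrable_continuous, of \<Omega> "\<lambda>_. 1" \<phi>] by simp

lemma integral_mult_test_fun_cong_AE:
  assumes "locally_integrable \<Omega> f" "locally_integrable \<Omega> g" "\<phi> \<in> test_fun \<Omega>"
    and ae: "AE x in lebesgue. x \<in> \<Omega> \<longrightarrow> f x = g x"
  shows "(LINT x:\<Omega>|lebesgue. f x * \<phi> x) = (LINT x:\<Omega>|lebesgue. g x * \<phi> x)"
  unfolding set_lebesgue_integral_def
proof (rule integral_cong_AE)
  show "AE x in lebesgue. indicator \<Omega> x *\<^sub>R (f x * \<phi> x) = indicator \<Omega> x *\<^sub>R (g x * \<phi> x)"
    using ae by eventually_elim (auto simp: indicator_def)
qed (use assms locally_integrable_mult_test_fun in
    \<open>auto simp: set_integrable_def intro!: borel_measurable_integrable\<close>)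

text \<open>Allows both a function and its weak derivative to be replaced by continuous
  representatives, for which pointwise arguments are possible.\<close>

lemma has_weak_deriv_cong_AE:
  assumes uv: "has_weak_deriv \<Omega> k u v"
    and "locally_integrable \<Omega> u'" "AE x in lebesgue. x \<in> \<Omega> \<longrightarrow> u x = u' x"
    and "locally_integrable \<Omega> v'" "AE x in lebesgue. x \<in> \<Omega> \<longrightarrow> v x = v' x"
  shows "has_weak_deriv \<Omega> k u' v'"
  unfolding has_weak_deriv_def
proof (intro conjI ballI)
  fix \<phi> assume \<phi>: "\<phi> \<in> test_fun \<Omega>"
  have "(deriv ^^ k) \<phi> \<in> test_fun \<Omega>"
    using \<phi> by (induction k) (auto intro: test_fun_deriv)
  then show "(LINT x:\<Omega>|lebesgue. u' x * (deriv ^^ k) \<phi> x) =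
      (- 1) ^ k * (LINT x:\<Omega>|lebesgue. v' x * \<phi> x)"
    using assms \<phi> integral_mult_test_fun_cong_AE[of \<Omega> u u' "(deriv ^^ k) \<phi>"]
      integral_mult_test_fun_cong_AE[of \<Omega> v v' \<phi>]
    by (simp add: has_weak_deriv_def)
qed (use assms in auto)

section \<open>The fundamental lemma of the calculus of variations\<close>

lemma set_integral_pos:
  fixes h :: "real \<Rightarrow> real"
  assumes h: "set_integrable lebesgue A h" "\<And>x. x \<in> A \<Longrightarrow> h x \<ge> 0"
    and cd: "c < d" "{c<..<d} \<subseteq> A" "\<And>x. x \<in> {c<..<d} \<Longrightarrow> h x > 0"
  shows "(LINT x:A|lebesgue. h x) > 0"
proof -
  have nonneg: "indicator A x *\<^sub>R h x \<ge> 0" for x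
    using h(2) by (auto simp: indicator_def)
  \<comment> \<open>A nonnegative function with integral zero vanishes almost everywhere, but this
    one is positive on an interval of positive length.\<close>
  have "(LINT x:A|lebesgue. h x) \<noteq> 0"
  proof
    assume "(LINT x:A|lebesgue. h x) = 0"
    then have "AE x in lebesgue. indicator A x *\<^sub>R h x = 0"
      using integral_nonneg_eq_0_iff_AE[of lebesgue "\<lambda>x. indicator A x *\<^sub>R h x"] h(1) nonneg
      by (simp add: set_lebesgue_integral_def set_integrable_def)
    then have "AE x in lebesgue. x \<notin> {c<..<d}"
      by eventually_elim (use cd in \<open>fastforce simp: indicator_def\<close>)
    then have "emeasure lebesgue {c<..<d} = 0"
      by (subst (asm) AE_iff_measurable[of "{c<..<d}"]) auto
    then show False using \<open>c < d\<close> by simp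
  qed
  moreover have "(LINT x:A|lebesgue. h x) \<ge> 0"
    unfolding set_lebesgue_integral_def by (rule Bochner_Integration.integral_nonneg) (rule nonneg)
  ultimately show ?thesis by simp
qed

lemma exists_test_fun_bump:
  assumes "{c..d} \<subseteq> \<Omega>"
  obtains \<phi> where "\<phi> \<in> test_fun \<Omega>" "\<And>x. \<phi> x \<ge> 0" "\<And>x. \<phi> x > 0 \<longleftrightarrow> x \<in> {c<..<d}"
proof -
  obtain f where f: "smooth f" "\<And>x. f x \<ge> 0" "\<And>x. f x > 0 \<longleftrightarrow> x \<in> {c<..<d}"
    using exists_smooth_bump by blast
  have "f x = 0" if "x \<notin> {c..d}" for x
    using f(2)[of x] f(3)[of x] that by auto
  then have "f \<in> test_fun \<Omega>"
    using test_funI[OF f(1) _ assms] by auto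
  then show ?thesis using that f by blast
qed

lemma exists_test_fun_integral_1:
  assumes "a < b"
  obtains \<eta> where "\<eta> \<in> test_fun {a<..<b}" "(LINT x:{a<..<b}|lebesgue. \<eta> x) = 1"
proof -
  obtain d where d: "a < d" "d < b" using dense[OF assms] by blast
  obtain c where c: "a < c" "c < d" using dense[OF d(1)] by blast
  have "{c..d} \<subseteq> {a<..<b}" using c d by auto
  then obtain \<phi> where \<phi>: "\<phi> \<in> test_fun {a<..<b}" "\<And>x. \<phi> x \<ge> 0" "\<And>x. \<phi> x > 0 \<longleftrightarrow> x \<in> {c<..<d}"
    using exists_test_fun_bump by blast
  define I where "I = (LINT x:{a<..<b}|lebesgue. \<phi> x)"
  have "I > 0"
    unfolding I_def using \<phi> c d by (intro set_integral_pos[of _ _ c d] test_fun_integrable) auto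
  moreover have "(\<lambda>x. (1 / I) * \<phi> x) \<in> test_fun {a<..<b}"
    using test_fun_lincomb[OF \<phi>(1,1), of "1 / I" 0] by simp
  ultimately show ?thesis
    using that[of "\<lambda>x. (1 / I) * \<phi> x"] by (simp add: I_def)
qed

text \<open>If \<open>f\<close> were nonzero at \<open>x\<close>, it would by continuity keep its
  sign near \<open>x\<close>, and its product with a bump living there would have a nonzero
  integral.\<close>

lemma eq_0_if_integral_mult_test_fun_eq_0:
  fixes f :: "real \<Rightarrow> real"
  assumes "open \<Omega>" "continuous_on \<Omega> f"
    and "\<And>\<phi>. \<phi> \<in> test_fun \<Omega> \<Longrightarrow> (LINT x:\<Omega>|lebesgue. f x * \<phi> x) = 0"
    and "x \<in> \<Omega>"
  shows "f x = 0"
proof -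
  \<comment> \<open>Stated for a general \<open>g\<close> so that it serves both for
    \<open>f\<close> and for its negative.\<close>
  have not_pos: "\<not> g x > 0" if g: "continuous_on \<Omega> g"
    "\<And>\<phi>. \<phi> \<in> test_fun \<Omega> \<Longrightarrow> (LINT x:\<Omega>|lebesgue. g x * \<phi> x) = 0" for g :: "real \<Rightarrow> real"
  proof
    assume "g x > 0"
    have "open (\<Omega> \<inter> g -` {0<..})"
      using continuous_open_preimage[OF g(1) \<open>open \<Omega>\<close>] by simp
    then obtain e where e: "e > 0" "cball x e \<subseteq> \<Omega> \<inter> g -` {0<..}"
      using \<open>x \<in> \<Omega>\<close> \<open>g x > 0\<close> open_contains_cball by (metis IntI greaterThan_iff vimageI2)
    then have sub: "{x - e..x + e} \<subseteq> \<Omega> \<inter> g -` {0<..}"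
      by (simp add: cball_eq_atLeastAtMost)
    then obtain \<phi> where \<phi>: "\<phi> \<in> test_fun \<Omega>" "\<And>y. \<phi> y \<ge> 0" "\<And>y. \<phi> y > 0 \<longleftrightarrow> y \<in> {x - e<..<x + e}"
      using exists_test_fun_bump[of "x - e" "x + e" \<Omega>] by auto
    have "\<phi> y = 0" if "y \<notin> {x - e<..<x + e}" for y
      using \<phi>(2)[of y] \<phi>(3)[of y] that by linarith
    moreover have g_pos: "g y > 0" if "y \<in> {x - e<..<x + e}" for y
      using sub that by (force dest: subsetD[of _ _ y])
    ultimately have "g y * \<phi> y \<ge> 0" for y
      using \<phi>(2)[of y] by (cases "y \<in> {x - e<..<x + e}") (auto simp: less_imp_le)
    moreover have "g y * \<phi> y > 0" if "y \<in> {x - e<..<x + e}" for y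
      using that \<phi>(3)[of y] g_pos by simp
    moreover have "set_integrable lebesgue \<Omega> (\<lambda>x. g x * \<phi> x)"
      using g(1) \<phi>(1) by (intro locally_integrable_mult_test_fun locally_integrable_continuous)
    moreover have "{x - e<..<x + e} \<subseteq> \<Omega>" using sub by force
    ultimately have "(LINT x:\<Omega>|lebesgue. g x * \<phi> x) > 0"
      using e(1) by (intro set_integral_pos[of _ _ "x - e" "x + e"]) auto
    then show False using g(2)[OF \<phi>(1)] by simp
  qed
  have "\<not> - f x > 0"
  proof (rule not_pos)
    show "continuous_on \<Omega> (\<lambda>x. - f x)"
      by (intro continuous_intros assms)
    show "(LINT x:\<Omega>|lebesgue. - f x * \<phi> x) = 0" if "\<phi> \<in> test_fun \<Omega>" for \<phi>
      using assms(3)[OF that] set_integral_mult_right[of lebesgue \<Omega> "- 1" "\<lambda>x. f x * \<phi> x"] by simp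
  qed
  with not_pos[of f] assms show ?thesis by force
qed

section \<open>Primitives of test functions and the du Bois-Reymond lemmas\<close>

lemma integral_test_fun_antideriv:
  assumes "a < b" "\<theta> \<in> test_fun {a<..<b}" "\<And>x. (F has_real_derivative \<theta> x) (at x)"
  shows "(LINT x:{a<..<b}|lebesgue. \<theta> x) = F b - F a"
proof -
  have "(\<theta> has_integral (F b - F a)) {a..b}"
    by (rule fundamental_theorem_of_calculus)
      (use assms in \<open>auto simp: has_real_derivative_iff_has_vector_derivative[symmetric]
        intro: has_field_derivative_at_within\<close>)
  then have "integral {a<..<b} \<theta> = F b - F a"
    by (simp add: integral_open_interval_real[symmetric] integral_unique)
  then show ?thesis
    using test_fun_integrable[OF assms(2)] by (simp add: set_lebesgue_integral_eq_integral(2))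
qed

lemma integral_test_fun_deriv:
  assumes "a < b" "\<phi> \<in> test_fun {a<..<b}"
  shows "(LINT x:{a<..<b}|lebesgue. deriv \<phi> x) = 0"
proof -
  have "\<phi> a = 0" "\<phi> b = 0"
    using test_fun_support[OF assms(2)] by (metis greaterThanLessThan_iff less_irrefl subsetD)+
  then show ?thesis
    using integral_test_fun_antideriv[OF assms(1) test_fun_deriv[OF assms(2)]
        smooth_DERIV[OF test_fun_smooth[OF assms(2)]]] by simp
qed

text \<open>Every primitive is constant on either side of the support of \<open>\<theta>\<close>.
  The one that vanishes at \<open>a\<close> is zero on the left, and on the right it equals the
  integral of \<open>\<theta>\<close>, which is zero; so its support is compact.\<close>

lemma exists_test_fun_antideriv:
  assumes "a < b" "\<theta> \<in> test_fun {a<..<b}" "(LINT x:{a<..<b}|lebesgue. \<theta> x) = 0"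
  obtains \<psi> where "\<psi> \<in> test_fun {a<..<b}" "deriv \<psi> = \<theta>"
proof -
  have smooth: "smooth \<theta>" using assms(2) by (rule test_fun_smooth)
  \<comment> \<open>Infinite end points give a primitive on the whole line, as smoothness and test
    functions are notions on all of the reals.\<close>
  obtain F where F: "\<And>x. (F has_real_derivative \<theta> x) (at x)"
    using einterval_antiderivative[of "-\<infinity>" \<infinity> \<theta>] smooth_isCont[OF smooth]
    by (auto simp: has_real_derivative_iff_has_vector_derivative)
  have const: "F x = F y" if "x \<in> S" "y \<in> S" "convex S" "\<And>z. z \<in> S \<Longrightarrow> \<theta> z = 0" for x y S
    using has_field_derivative_zero_constant[of S F] F that
    by (metis has_field_derivative_at_within)
  obtain K where K: "compact K" "K \<subseteq> {a<..<b}" "\<And>x. x \<notin> K \<Longrightarrow> \<theta> x = 0"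
    using test_fun_support[OF assms(2)] by blast
  obtain c d where cd: "a < c" "c \<le> d" "d < b" "K \<subseteq> {c..d}"
    using compact_subset_open_interval[OF K(1,2) assms(1)] by blast
  have "F b = F a"
    using integral_test_fun_antideriv[OF assms(1,2) F] assms(3) by simp
  have supp: "F x - F a = 0" if "x \<notin> {c..d}" for x
  proof (cases "x < c")
    case True
    then show ?thesis using const[of x "{..<c}" a] cd K(3) by force
  next
    case False
    then show ?thesis using const[of x "{d<..}" b] cd K(3) that \<open>F b = F a\<close> by force
  qed
  have deriv: "((\<lambda>x. F x - F a) has_real_derivative \<theta> x) (at x)" for x
    by (auto intro!: derivative_eq_intros F)
  have "smooth (\<lambda>x. F x - F a)"
    using smooth deriv by (rule smooth_antideriv)
  then have "(\<lambda>x. F x - F a) \<in> test_fun {a<..<b}"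
    by (rule test_funI[OF _ _ _ supp]) (use cd(1,3) in auto)
  moreover have "deriv (\<lambda>x. F x - F a) = \<theta>"
    using deriv by (auto intro!: DERIV_imp_deriv)
  ultimately show ?thesis using that by blast
qed

lemma integral_lincomb_mult_test_fun:
  assumes "locally_integrable \<Omega> f" "\<phi> \<in> test_fun \<Omega>" "\<psi> \<in> test_fun \<Omega>"
  shows "(LINT x:\<Omega>|lebesgue. f x * (\<phi> x - r * \<psi> x)) =
    (LINT x:\<Omega>|lebesgue. f x * \<phi> x) - r * (LINT x:\<Omega>|lebesgue. f x * \<psi> x)"
proof -
  have "f x * (\<phi> x - r * \<psi> x) = f x * \<phi> x - r * (f x * \<psi> x)" for x
    by (simp add: algebra_simps)
  then show ?thesis
    using assms by (simp add: set_integral_diff locally_integrable_mult_test_fun)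
qed

text \<open>Subtracting the multiple of \<open>\<eta>\<close> with the same integral as
  \<open>\<phi>\<close> leaves a test function of integral zero, and such a function has a primitive
  among the test functions.\<close>

lemma test_fun_decompose:
  assumes "a < b" "\<phi> \<in> test_fun {a<..<b}"
    and "\<eta> \<in> test_fun {a<..<b}" "(LINT x:{a<..<b}|lebesgue. \<eta> x) = 1"
  obtains \<psi> where "\<psi> \<in> test_fun {a<..<b}"
    "deriv \<psi> = (\<lambda>x. \<phi> x - (LINT x:{a<..<b}|lebesgue. \<phi> x) * \<eta> x)"
proof (rule exists_test_fun_antideriv[OF assms(1)])
  let ?I = "LINT x:{a<..<b}|lebesgue. \<phi> x"
  show "(\<lambda>x. \<phi> x - ?I * \<eta> x) \<in> test_fun {a<..<b}"
    using test_fun_lincomb[OF assms(2,3), of 1 "- ?I"] by simp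
  \<comment> \<open>With the weight 1, the linearity lemma for weighted integrals computes the plain
    integral.\<close>
  have "locally_integrable {a<..<b} (\<lambda>_. 1)"
    by (simp add: locally_integrable_continuous)
  from integral_lincomb_mult_test_fun[OF this assms(2,3), of ?I]
  show "(LINT x:{a<..<b}|lebesgue. \<phi> x - ?I * \<eta> x) = 0"
    using assms(4) by simp
qed

text \<open>Testing with the \<open>\<psi>\<close> of the decomposition shows that \<open>f\<close>
  and the constant \<open>C\<close>, its mean with weight \<open>\<eta>\<close>, have the same
  integral against every \<open>\<phi>\<close>; the fundamental lemma then identifies them.\<close>

lemma constant_if_integral_deriv_test_fun_eq_0:
  assumes "a < b" and cont: "continuous_on {a<..<b} f"
    and f: "\<And>\<phi>. \<phi> \<in> test_fun {a<..<b} \<Longrightarrow> (LINT x:{a<..<b}|lebesgue. f x * deriv \<phi> x) = 0"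
  obtains C where "\<And>x. x \<in> {a<..<b} \<Longrightarrow> f x = C"
proof -
  let ?int = "\<lambda>g. LINT x:{a<..<b}|lebesgue. g x"
  note li = locally_integrable_continuous[OF cont]
  obtain \<eta> where \<eta>: "\<eta> \<in> test_fun {a<..<b}" "?int \<eta> = 1"
    using exists_test_fun_integral_1[OF assms(1)] by blast
  define C where "C = ?int (\<lambda>x. f x * \<eta> x)"
  have "f x - C = 0" if "x \<in> {a<..<b}" for x
  proof (rule eq_0_if_integral_mult_test_fun_eq_0[OF _ _ _ that])
    fix \<phi> assume \<phi>: "\<phi> \<in> test_fun {a<..<b}"
    obtain \<psi> where \<psi>: "\<psi> \<in> test_fun {a<..<b}" "deriv \<psi> = (\<lambda>x. \<phi> x - ?int \<phi> * \<eta> x)"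
      using test_fun_decompose[OF assms(1) \<phi> \<eta>] by blast
    have "?int (\<lambda>x. f x * \<phi> x) = ?int \<phi> * C"
      using f[OF \<psi>(1)] integral_lincomb_mult_test_fun[OF li \<phi> \<eta>(1)] unfolding \<psi>(2) C_def by simp
    then show "?int (\<lambda>x. (f x - C) * \<phi> x) = 0"
      using locally_integrable_mult_test_fun[OF li \<phi>] test_fun_integrable[OF \<phi>]
      by (simp add: left_diff_distrib set_integral_diff)
  qed (use cont in \<open>auto intro!: continuous_intros\<close>)
  then show ?thesis using that[of C] by simp
qed

text \<open>Reduces to the first-order lemma: once the right slope \<open>k\<close> is known,
  \<open>f x - k * x\<close> integrates to zero against every \<open>deriv \<phi>\<close>.\<close>

lemma affine_if_integral_deriv2_test_fun_eq_0:
  assumes "a < b" and cont: "continuous_on {a<..<b} f"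
    and f: "\<And>\<phi>. \<phi> \<in> test_fun {a<..<b} \<Longrightarrow> (LINT x:{a<..<b}|lebesgue. f x * deriv (deriv \<phi>) x) = 0"
  obtains C k where "\<And>x. x \<in> {a<..<b} \<Longrightarrow> f x = C + k * x"
proof -
  let ?int = "\<lambda>g. LINT x:{a<..<b}|lebesgue. g x"
  note li = locally_integrable_continuous[OF cont]
  obtain \<eta> where \<eta>: "\<eta> \<in> test_fun {a<..<b}" "?int \<eta> = 1"
    using exists_test_fun_integral_1[OF assms(1)] by blast
  \<comment> \<open>For \<open>f x = C + k * x\<close>, integration by parts gives exactly this
    value, because \<open>\<eta>\<close> has integral 1.\<close>
  define k where "k = - ?int (\<lambda>x. f x * deriv \<eta> x)"
  have li': "locally_integrable {a<..<b} (\<lambda>x. x)"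
    by (intro locally_integrable_continuous continuous_intros)
  have "?int (\<lambda>x. (f x - k * x) * deriv \<phi> x) = 0" if \<phi>: "\<phi> \<in> test_fun {a<..<b}" for \<phi>
  proof -
    note d\<phi> = test_fun_deriv[OF \<phi>]
    obtain \<psi> where \<psi>: "\<psi> \<in> test_fun {a<..<b}" "deriv \<psi> = (\<lambda>x. \<phi> x - ?int \<phi> * \<eta> x)"
      using test_fun_decompose[OF assms(1) \<phi> \<eta>] by blast
    have "deriv (deriv \<psi>) = (\<lambda>x. deriv \<phi> x - ?int \<phi> * deriv \<eta> x)"
      unfolding \<psi>(2)
      by (intro ext DERIV_imp_deriv)
        (auto intro!: derivative_eq_intros smooth_DERIV test_fun_smooth[OF \<phi>] test_fun_smooth[OF \<eta>(1)])
    \<comment> \<open>The left side of the hypothesis at \<open>\<psi>\<close> splits into the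
      integrals of \<open>f\<close> against \<open>deriv \<phi>\<close> and against
      \<open>deriv \<eta>\<close>; the latter is \<open>- k\<close>.\<close>
    then have 1: "?int (\<lambda>x. f x * deriv \<phi> x) = - k * ?int \<phi>"
      using f[OF \<psi>(1)] integral_lincomb_mult_test_fun[OF li d\<phi> test_fun_deriv[OF \<eta>(1)]]
      by (simp add: k_def)
    \<comment> \<open>Integration by parts for x against \<open>deriv \<phi>\<close>: the derivative
      of this test function has integral zero.\<close>
    have x\<phi>: "(\<lambda>x. x * \<phi> x) \<in> test_fun {a<..<b}"
    proof -
      obtain K where "compact K" "K \<subseteq> {a<..<b}" "\<And>x. x \<notin> K \<Longrightarrow> \<phi> x = 0"
        using test_fun_support[OF \<phi>] by blast
      moreover have "smooth (\<lambda>x. x)"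
      proof -
        \<comment> \<open>Only the zero function needs a class of its own; 1 and x follow as
          successive primitives.\<close>
        have "smooth (\<lambda>_. 0)" by (rule smooth_coinduct[where P = "\<lambda>g. g = (\<lambda>_. 0)"]) auto
        then have "smooth (\<lambda>_. 1)" by (rule smooth_antideriv) auto
        then show ?thesis by (rule smooth_antideriv) auto
      qed
      ultimately show ?thesis
        using smooth_mult test_fun_smooth[OF \<phi>] by (intro test_funI[of _ K]) auto
    qed
    have "deriv (\<lambda>x. x * \<phi> x) = (\<lambda>x. \<phi> x + x * deriv \<phi> x)"
      by (intro ext DERIV_imp_deriv)
        (auto intro!: derivative_eq_intros smooth_DERIV test_fun_smooth[OF \<phi>])
    then have "?int \<phi> + ?int (\<lambda>x. x * deriv \<phi> x) = 0"
      using integral_test_fun_deriv[OF assms(1) x\<phi>] test_fun_integrable[OF \<phi>]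
        locally_integrable_mult_test_fun[OF li' d\<phi>]
      by (simp add: set_integral_add)
    moreover have "?int (\<lambda>x. (f x - k * x) * deriv \<phi> x) =
        ?int (\<lambda>x. f x * deriv \<phi> x) - k * ?int (\<lambda>x. x * deriv \<phi> x)"
      using locally_integrable_mult_test_fun[OF li d\<phi>] locally_integrable_mult_test_fun[OF li' d\<phi>]
      by (simp add: left_diff_distrib set_integral_diff mult.assoc)
    ultimately show ?thesis
      using 1 by (simp add: eq_neg_iff_add_eq_0[symmetric])
  qed
  moreover have "continuous_on {a<..<b} (\<lambda>x. f x - k * x)"
    by (intro continuous_intros cont)
  ultimately obtain C where "\<And>x. x \<in> {a<..<b} \<Longrightarrow> f x - k * x = C"
    using constant_if_integral_deriv_test_fun_eq_0[OF assms(1)] by blast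
  then show ?thesis
    using that[of C k] by (auto simp: algebra_simps)
qed

section \<open>Open intervals and positive steady states\<close>

lemma open_bounded_interval_eq:
  fixes \<Omega> :: "real set"
  assumes "open \<Omega>" "is_interval \<Omega>" "bounded \<Omega>" "\<Omega> \<noteq> {}"
  obtains a b where "a < b" "\<Omega> = {a<..<b}"
proof (rule that)
  have bdd: "bdd_above \<Omega>" "bdd_below \<Omega>"
    using assms(3) by (auto intro: bounded_imp_bdd_above bounded_imp_bdd_below)
  \<comment> \<open>Openness leaves no least or greatest element, so the infimum and the supremum
    are strict bounds.\<close>
  have "\<exists>y\<in>\<Omega>. y < x" "\<exists>y\<in>\<Omega>. x < y" if "x \<in> \<Omega>" for x
  proof -
    obtain e where "e > 0" "cball x e \<subseteq> \<Omega>"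
      using assms(1) \<open>x \<in> \<Omega>\<close> open_contains_cball by blast
    then have "x - e \<in> \<Omega>" "x + e \<in> \<Omega>"
      by (auto simp: cball_eq_atLeastAtMost)
    then show "\<exists>y\<in>\<Omega>. y < x" "\<exists>y\<in>\<Omega>. x < y"
      using \<open>e > 0\<close> by (auto intro: bexI[of _ "x - e"] bexI[of _ "x + e"])
  qed
  then have sub: "Inf \<Omega> < x \<and> x < Sup \<Omega>" if "x \<in> \<Omega>" for x
    using that bdd by (meson cInf_lower cSup_upper le_less_trans less_le_trans)
  have "x \<in> \<Omega>" if "x \<in> {Inf \<Omega><..<Sup \<Omega>}" for x
  proof -
    have "Inf \<Omega> < x" "x < Sup \<Omega>" using that by auto
    then obtain y z where "y \<in> \<Omega>" "y < x" "z \<in> \<Omega>" "x < z"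
      unfolding cInf_less_iff[OF assms(4) bdd(2)] less_cSup_iff[OF assms(4) bdd(1)] by blast
    then show ?thesis
      using assms(2) unfolding is_interval_1 by (meson less_imp_le)
  qed
  moreover have "x \<in> {Inf \<Omega><..<Sup \<Omega>}" if "x \<in> \<Omega>" for x
    using sub[OF that] by simp
  ultimately show "\<Omega> = {Inf \<Omega><..<Sup \<Omega>}" by blast
  obtain x where "x \<in> \<Omega>" using assms(4) by blast
  then show "Inf \<Omega> < Sup \<Omega>"
    using sub[of x] by linarith
qed

text \<open>Positivity of the continuous representative passes to \<open>u\<close> almost
  everywhere, so the first factor can be cancelled. As \<open>powr\<close> is zero only at base 0,
  the factor with exponent \<open>\<alpha> - 1\<close> vanishes only where \<open>w\<close> does,
  also for \<open>\<alpha>\<close> < 1.\<close>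

lemma steady_state_third_weak_deriv_eq_0:
  assumes "positive_steady_state \<alpha> \<Omega> u"
  shows "\<exists>w. has_weak_deriv \<Omega> 3 u w \<and> (AE x in lebesgue. x \<in> \<Omega> \<longrightarrow> w x = 0)"
proof -
  obtain w where w: "has_weak_deriv \<Omega> 3 u w"
    "AE x in lebesgue. x \<in> \<Omega> \<longrightarrow> u x powr (\<alpha> + 2) * \<bar>w x\<bar> powr (\<alpha> - 1) * w x = 0"
    using assms by (auto simp: positive_steady_state_def steady_state_def)
  obtain g where g: "AE x in lebesgue. x \<in> \<Omega> \<longrightarrow> u x = g x" "\<forall>x\<in>closure \<Omega>. g x > 0"
    using assms by (auto simp: positive_steady_state_def cont_rep_def)
  from g(1) have "AE x in lebesgue. x \<in> \<Omega> \<longrightarrow> u x > 0"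
    by eventually_elim (use g(2) closure_subset[of \<Omega>] in auto)
  with w(2) have "AE x in lebesgue. x \<in> \<Omega> \<longrightarrow> w x = 0"
    by eventually_elim auto
  with w(1) show ?thesis by blast
qed

theorem theorem3p5:
  fixes \<Omega> :: "real set" and \<alpha> :: real and u :: "real \<Rightarrow> real"
  assumes "open \<Omega>" and "is_interval \<Omega>" and "bounded \<Omega>" and "\<Omega> \<noteq> {}"
    and "\<alpha> > 0"
    and "u \<in> W3B \<alpha> \<Omega>"
  shows "positive_steady_state \<alpha> \<Omega> u \<longleftrightarrow>
         (\<exists>c>0. AE x in lebesgue. x \<in> \<Omega> \<longrightarrow> u x = c)"
proof
  obtain a b where ab: "a < b" "\<Omega> = {a<..<b}"
    using open_bounded_interval_eq assms by blast
  have zero: "locally_integrable \<Omega> (\<lambda>_. 0)" and const: "locally_integrable \<Omega> (\<lambda>_. c)" for c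
    by (simp_all add: locally_integrable_continuous)
  {
    assume pos: "positive_steady_state \<alpha> \<Omega> u"
    then obtain g where g: "continuous_on {a..b} g" "AE x in lebesgue. x \<in> \<Omega> \<longrightarrow> u x = g x"
      "\<forall>x\<in>{a..b}. g x > 0"
      using ab by (auto simp: positive_steady_state_def cont_rep_def)
    obtain w h where h: "has_weak_deriv \<Omega> 1 u w" "continuous_on {a..b} h"
      "AE x in lebesgue. x \<in> \<Omega> \<longrightarrow> w x = h x" "h a = 0" "h b = 0"
      using assms(6) ab by (auto simp: W3B_def cont_rep_def frontier_def)
    have cont: "continuous_on \<Omega> g" "continuous_on \<Omega> h"
      using g(1) h(2) ab by (auto intro: continuous_on_subset)
    have gh: "has_weak_deriv \<Omega> 1 g h"
      using has_weak_deriv_cong_AE h(1,3) g(2) cont[THEN locally_integrable_continuous] by blast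
    have g0: "has_weak_deriv \<Omega> 3 g (\<lambda>_. 0)"
      using has_weak_deriv_cong_AE g(2) locally_integrable_continuous[OF cont(1)] zero
        steady_state_third_weak_deriv_eq_0[OF pos] by blast
    have "(LINT x:\<Omega>|lebesgue. h x * deriv (deriv \<phi>) x) = 0" if "\<phi> \<in> test_fun \<Omega>" for \<phi>
    proof -
      \<comment> \<open>The first-order identity between \<open>g\<close> and \<open>h\<close> is
        tested with \<open>deriv (deriv \<phi>)\<close>, which turns the third-order identity for
        \<open>g\<close> into a second-order one for \<open>h\<close>.\<close>
      have "(LINT x:\<Omega>|lebesgue. h x * deriv (deriv \<phi>) x) =
          - (LINT x:\<Omega>|lebesgue. g x * deriv (deriv (deriv \<phi>)) x)"
        using gh that test_fun_deriv by (auto simp: has_weak_deriv_def)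
      also have "\<dots> = 0"
        using g0 that by (auto simp: has_weak_deriv_def eval_nat_numeral)
      finally show ?thesis .
    qed
    then obtain C k where Ck: "\<And>x. x \<in> \<Omega> \<Longrightarrow> h x = C + k * x"
      using affine_if_integral_deriv2_test_fun_eq_0[OF ab(1), of h] cont(2) unfolding ab(2) by blast
    \<comment> \<open>The affine formula is known only inside the interval; continuity carries it to
      the end points, where the boundary condition gives two equations for \<open>C\<close> and
      \<open>k\<close>.\<close>
    have "continuous_on {a..b} (\<lambda>x. h x - k * x)"
      by (intro continuous_intros h(2))
    then have "h x - k * x = C" if "x \<in> {a..b}" for x
      using continuous_constant_on_closure[of \<Omega> "\<lambda>x. h x - k * x" C x] Ck that ab by simp
    from this[of a] this[of b] have "k * (b - a) = 0" "C = - (k * a)"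
      using ab(1) h(4,5) by (auto simp: algebra_simps)
    then have "C = 0" "k = 0" using ab(1) by auto
    then have "h x = 0" if "x \<in> \<Omega>" for x using Ck that by simp
    then have "(LINT x:\<Omega>|lebesgue. h x * \<phi> x) = 0" for \<phi>
      using set_lebesgue_integral_cong[of \<Omega> lebesgue "\<lambda>x. h x * \<phi> x" "\<lambda>_. 0"] ab(2) by simp
    then have "(LINT x:\<Omega>|lebesgue. g x * deriv \<phi> x) = 0" if "\<phi> \<in> test_fun \<Omega>" for \<phi>
      using gh that by (auto simp: has_weak_deriv_def)
    then obtain c where c: "\<And>x. x \<in> \<Omega> \<Longrightarrow> g x = c"
      using constant_if_integral_deriv_test_fun_eq_0[OF ab(1), of g] cont(1) unfolding ab(2) by blast
    moreover have "c > 0"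
      using c[of "(a + b) / 2"] g(3) ab by (auto simp: field_simps)
    ultimately show "\<exists>c>0. AE x in lebesgue. x \<in> \<Omega> \<longrightarrow> u x = c"
      using g(2) by (auto elim!: eventually_mono)
  next
    assume "\<exists>c>0. AE x in lebesgue. x \<in> \<Omega> \<longrightarrow> u x = c"
    then obtain c where c: "c > 0" "AE x in lebesgue. x \<in> \<Omega> \<longrightarrow> u x = c" by blast
    have "locally_integrable \<Omega> u"
      using assms(6) by (auto simp: W3B_def has_weak_deriv_def)
    \<comment> \<open>The third derivative of a test function is the derivative of a test function,
      so its integral is zero.\<close>
    moreover have "has_weak_deriv \<Omega> 3 (\<lambda>_. c) (\<lambda>_. 0)"
      using zero const ab integral_test_fun_deriv[OF ab(1)] test_fun_deriv
      by (auto simp: has_weak_deriv_def eval_nat_numeral)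
    moreover have "AE x in lebesgue. x \<in> \<Omega> \<longrightarrow> c = u x"
      using c(2) by (auto elim!: eventually_mono)
    ultimately have "has_weak_deriv \<Omega> 3 u (\<lambda>_. 0)"
      using has_weak_deriv_cong_AE[of \<Omega> 3 "\<lambda>_. c" "\<lambda>_. 0" u "\<lambda>_. 0"] zero by simp
    then have "steady_state \<alpha> \<Omega> u"
      using assms(6) by (auto simp: steady_state_def)
    moreover have "cont_rep \<Omega> u (\<lambda>_. c)"
      using c(2) by (simp add: cont_rep_def)
    ultimately show "positive_steady_state \<alpha> \<Omega> u"
      using c(1) by (auto simp: positive_steady_state_def)
  }
qed

end
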